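(* Let $G$ be a graph with an orientation $\vec G$ and an $\mathbb{S}^2$-flow $\varphi$ on $\vec G$ such that $S_{\mathbb{Q}}(\varphi)$ is odd-coordinate-free and has rank (dimension over $\mathbb{Q}$) at most $2$. Then $G$ admits a $4$-flow.
   Context: Graphs are finite. For an orientation $\vec G$, $E^+(v)$ (resp. $E^-(v)$) denotes the set of edges with tail (resp. head) $v$ and other end different from $v$. An $\mathbb{S}^2$-flow on $\vec G$ is a map $\varphi$ from the edges to unit vectors of $\mathbb{R}^3$ with $\sum_{e\in E^+(v)}\varphi(e)=\sum_{e\in E^-(v)}\varphi(e)$ at every vertex $v$. Let $\{\varphi(e): e\in E(\vec G)\}=\{\mathbf v_1,\dots,\mathbf v_b\}$ (distinct vectors) and $E_i=\{e:\varphi(e)=\mathbf v_i\}$. For a vertex $v$ set $\epsilon_i(v)=|E^+(v)\cap E_i|-|E^-(v)\cap E_i|$ and $\boldsymbol\epsilon(v)=(\epsilon_1(v),\dots,\epsilon_b(v))\in\mathbb{Z}^b$. $S_{\mathbb{Q}}(\varphi)$ is the $\mathbb{Q}$-linear span of $\{\boldsymbol\epsilon(v):v\in V(G)\}$ in $\mathbb{Q}^b$. A subspace of $\mathbb{Q}^b$ is odd-coordinate-free if it contains no integer vector with exactly one odd coordinate. A $4$-flow of $G$ is a map $\psi$ from the edges of some orientation of $G$ to $\mathbb{Z}$ with $0<|\psi(e)|<4$ for all $e$ and $\sum_{e\in E^+(v)}\psi(e)=\sum_{e\in E^-(v)}\psi(e)$ at every vertex. *)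

theory Defs
  imports
    "HOL-Analysis.Analysis"
    "Graph_Theory.Digraph"
    "Jordan_Normal_Form.VS_Connect"
begin

text \<open>
  Undirected graphs may have parallel edges and loops: \<open>ends e\<close> is the set of end
  vertices of the edge \<open>e\<close>, a singleton exactly when \<open>e\<close> is a loop.
\<close>

record ('v, 'e) multigraph =
  vertices :: "'v set"
  edges :: "'e set"
  ends :: "'e \<Rightarrow> 'v set"

definition finite_multigraph :: "('v, 'e) multigraph \<Rightarrow> bool" where
  "finite_multigraph G \<longleftrightarrow>
     finite (vertices G) \<and> finite (edges G) \<and>
     (\<forall>e \<in> edges G. ends G e \<subseteq> vertices G \<and> card (ends G e) \<in> {1, 2})"

definition orientation_of :: "('v, 'e) pre_digraph \<Rightarrow> ('v, 'e) multigraph \<Rightarrow> bool" where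
  "orientation_of D G \<longleftrightarrow>
     verts D = vertices G \<and> arcs D = edges G \<and>
     (\<forall>e \<in> edges G. {tail D e, head D e} = ends G e)"

text \<open>Unlike \<^const>\<open>out_arcs\<close> and \<^const>\<open>in_arcs\<close>, these omit the loops at \<open>v\<close>.\<close>

definition E_plus :: "('v, 'e) pre_digraph \<Rightarrow> 'v \<Rightarrow> 'e set" where
  "E_plus D v = {e \<in> arcs D. tail D e = v \<and> head D e \<noteq> v}"

definition E_minus :: "('v, 'e) pre_digraph \<Rightarrow> 'v \<Rightarrow> 'e set" where
  "E_minus D v = {e \<in> arcs D. head D e = v \<and> tail D e \<noteq> v}"

definition conserved :: "('v, 'e) pre_digraph \<Rightarrow> ('e \<Rightarrow> 'a :: comm_monoid_add) \<Rightarrow> bool" where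
  "conserved D f \<longleftrightarrow> (\<forall>v \<in> verts D. (\<Sum>e\<in>E_plus D v. f e) = (\<Sum>e\<in>E_minus D v. f e))"

definition S2_flow :: "('v, 'e) pre_digraph \<Rightarrow> ('e \<Rightarrow> real ^ 3) \<Rightarrow> bool" where
  "S2_flow D \<phi> \<longleftrightarrow> (\<forall>e \<in> arcs D. \<phi> e \<in> sphere 0 1) \<and> conserved D \<phi>"

definition admits_flow :: "int \<Rightarrow> ('v, 'e) multigraph \<Rightarrow> bool" where
  "admits_flow k G \<longleftrightarrow>
     (\<exists>D (\<psi> :: 'e \<Rightarrow> int). orientation_of D G \<and>
        (\<forall>e \<in> edges G. 0 < \<bar>\<psi> e\<bar> \<and> \<bar>\<psi> e\<bar> < k) \<and> conserved D \<psi>)"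

text \<open>
  The list \<open>us\<close> enumerates the distinct values of \<open>\<phi>\<close>; its length is \<open>b\<close> and
  coordinates are counted from 0.  Elements of \<open>\<rat>\<^sup>b\<close> and \<open>\<int>\<^sup>b\<close> are vectors of
  dimension \<open>b\<close> in the sense of \<^theory>\<open>Jordan_Normal_Form.Matrix\<close>.
\<close>

definition edge_class ::
    "('v, 'e) pre_digraph \<Rightarrow> ('e \<Rightarrow> real ^ 3) \<Rightarrow> (real ^ 3) list \<Rightarrow> nat \<Rightarrow> 'e set" where
  "edge_class D \<phi> us i = {e \<in> arcs D. \<phi> e = us ! i}"

definition eps ::
    "('v, 'e) pre_digraph \<Rightarrow> ('e \<Rightarrow> real ^ 3) \<Rightarrow> (real ^ 3) list \<Rightarrow> 'v \<Rightarrow> int Matrix.vec" where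
  "eps D \<phi> us v = Matrix.vec (length us)
     (\<lambda>i. int (card (E_plus D v \<inter> edge_class D \<phi> us i))
        - int (card (E_minus D v \<inter> edge_class D \<phi> us i)))"

definition S_Q ::
    "('v, 'e) pre_digraph \<Rightarrow> ('e \<Rightarrow> real ^ 3) \<Rightarrow> (real ^ 3) list \<Rightarrow> rat Matrix.vec set" where
  "S_Q D \<phi> us = LinearCombinations.module.span class_ring (module_vec TYPE(rat) (length us))
     ((\<lambda>v. map_vec rat_of_int (eps D \<phi> us v)) ` verts D)"

definition rank_Q :: "nat \<Rightarrow> rat Matrix.vec set \<Rightarrow> nat" where
  "rank_Q b S = vectorspace.dim class_ring ((module_vec TYPE(rat) b)\<lparr>carrier := S\<rparr>)"

definition odd_coordinate_free :: "nat \<Rightarrow> rat Matrix.vec set \<Rightarrow> bool" where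
  "odd_coordinate_free b S \<longleftrightarrow>
     \<not> (\<exists>x :: int Matrix.vec. x \<in> carrier_vec b \<and> map_vec rat_of_int x \<in> S \<and>
          card {i. i < b \<and> odd (vec_index x i)} = 1)"

end

theory Submission
  imports Defs
begin

text \<open>
  The parities of the integer vectors in \<open>S\<^sub>\<rat>(\<phi>)\<close> form a subspace of the \<open>F\<^sub>2\<close>-space of subsets of
  the index set: a rational relation between three vectors can be scaled to coprime integer
  coefficients, so the subspace has dimension at most 2, hence it consists of
  \<open>{}\<close>, \<open>X\<close>, \<open>Y\<close> and the symmetric difference of \<open>X\<close> and \<open>Y\<close>, and none of these is a singleton.
  Then each index can be given a nonzero value in \<open>F\<^sub>2 \<times> F\<^sub>2\<close> such that the values sum to 0 over each
  of these sets, and giving every edge the value of its class yields a nowhere-zero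
  \<open>F\<^sub>2 \<times> F\<^sub>2\<close>-flow.  Its two coordinates are sets \<open>C\<^sub>1\<close>, \<open>C\<^sub>2\<close> of edges that cover the graph and
  have even degree everywhere; they carry flows \<open>f\<^sub>1\<close>, \<open>f\<^sub>2\<close> with values \<open>\<plusminus>1\<close>, and
  \<open>f\<^sub>1 + 2 f\<^sub>2\<close> is a 4-flow.
\<close>

section \<open>Flows with values 1 and -1 on edge sets of even degree\<close>

text \<open>Induction on the number of edges. A loop contributes nothing and may take either sign.
  At the head of a non-loop \<open>e\<close>, evenness yields a second edge \<open>e'\<close>; the
  two are merged into one, and the sign found for the merged edge is passed back to both. Merging
  alters the head of \<open>e\<close> and keeps all tails, so \<open>h\<close> is generalized and
  \<open>t\<close> is not.\<close>

lemma even_set_nowhere_zero_signing: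
  fixes t h :: "'e \<Rightarrow> 'v"
  assumes "finite C"
    and "\<And>x. even (\<Sum>e\<in>C. of_bool (t e = x) - of_bool (h e = x) :: int)"
  shows "\<exists>f :: 'e \<Rightarrow> int. (\<forall>e\<in>C. \<bar>f e\<bar> = 1) \<and>
    (\<forall>x. (\<Sum>e\<in>C. f e * (of_bool (t e = x) - of_bool (h e = x))) = 0)"
  using assms
proof (induction "card C" arbitrary: C h rule: less_induct)
  case less
  define d :: "('e \<Rightarrow> 'v) \<Rightarrow> 'v \<Rightarrow> 'e \<Rightarrow> int"
    where "d h x e = of_bool (t e = x) - of_bool (h e = x)" for h x e
  note even_d = less.prems(2)[folded d_def]
  show ?case
  proof (cases "C = {}")
    case False
    then obtain e where e: "e \<in> C" by blast
    show ?thesis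
    proof (cases "t e = h e")
      case True
      have d0: "d h x e = 0" for x using True by (simp add: d_def)
      have "even (\<Sum>a\<in>C - {e}. d h x a)" for x
        using even_d[of x] d0 by (simp add: sum.remove[OF less.prems(1) e])
      moreover have "card (C - {e}) < card C"
        using e less.prems(1) by (meson card_Diff1_less)
      ultimately obtain f :: "'e \<Rightarrow> int" where f: "\<forall>a\<in>C - {e}. \<bar>f a\<bar> = 1"
        "\<And>x. (\<Sum>a\<in>C - {e}. f a * d h x a) = 0"
        using less.hyps[of "C - {e}" h] less.prems(1) unfolding d_def by auto
      define g where "g = f(e := 1)"
      have "(\<Sum>a\<in>C. g a * d h x a) = 0" for x
      proof -
        have "(\<Sum>a\<in>C. g a * d h x a) = (\<Sum>a\<in>C - {e}. g a * d h x a)"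
          by (simp add: sum.remove[OF less.prems(1) e] d0)
        also have "\<dots> = (\<Sum>a\<in>C - {e}. f a * d h x a)"
          by (rule sum.cong) (auto simp: g_def)
        finally show ?thesis by (simp add: f(2))
      qed
      moreover have "\<forall>a\<in>C. \<bar>g a\<bar> = 1" using f(1) by (auto simp: g_def)
      ultimately show ?thesis unfolding d_def by blast
    next
      case False
      define v where "v = h e"
      have "d h v e = -1" using False by (simp add: d_def v_def)
      \<comment> \<open>The edge \<open>e\<close> contributes an odd amount to an even total at
        \<open>v\<close>, so some other edge does too.\<close>
      then have "odd (\<Sum>a\<in>C - {e}. d h v a)"
        using even_d[of v] by (simp add: sum.remove[OF less.prems(1) e])
      then obtain e' where e': "e' \<in> C" "e' \<noteq> e" "odd (d h v e')"
        using dvd_sum[of "C - {e}" 2 "d h v"] by blast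
      \<comment> \<open>\<open>w\<close> is the end of \<open>e'\<close> other than
        \<open>v\<close>. Up to the sign \<open>s\<close>, which is -1 when \<open>e'\<close> points
        into \<open>v\<close>, the edge \<open>e'\<close> runs from \<open>v\<close> to
        \<open>w\<close>.\<close>
      define s :: int where "s = (if t e' = v then 1 else -1)"
      define w where "w = (if t e' = v then h e' else t e')"
      have s: "d h x e' = s * (of_bool (v = x) - of_bool (w = x))" for x
        using e'(3) by (auto simp: d_def s_def w_def split: if_splits)
      have abs_s: "\<bar>s\<bar> = 1" "s * s = 1" by (auto simp: s_def)
      \<comment> \<open>Edges \<open>e\<close> into \<open>v\<close> and \<open>e'\<close> between \<open>v\<close> and \<open>w\<close> are spliced into one edge ending at \<open>w\<close>.\<close>
      define k where "k = h(e := w)"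
      have dk: "d h x e + s * d h x e' = d k x e" for x
      proof -
        have "s * d h x e' = of_bool (v = x) - of_bool (w = x)"
          by (simp add: s abs_s(2) flip: mult.assoc)
        then show ?thesis by (simp add: d_def k_def v_def)
      qed
      have dk': "d k x a = d h x a" if "a \<noteq> e" for x a
        using that by (simp add: d_def k_def)
      have eC: "e \<in> C - {e'}" using e e' by blast
      have split: "(\<Sum>a\<in>C. g a * d h x a) =
          g e' * d h x e' + (g e * d h x e + (\<Sum>a\<in>C - {e'} - {e}. g a * d h x a))" for g x
        using sum.remove[OF less.prems(1) e'(1), of "\<lambda>a. g a * d h x a"]
          sum.remove[OF _ eC, of "\<lambda>a. g a * d h x a"] less.prems(1) by simp
      have split': "(\<Sum>a\<in>C - {e'}. g a * d k x a) =
          g e * d k x e + (\<Sum>a\<in>C - {e'} - {e}. g a * d h x a)" for g x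
        using sum.remove[OF _ eC, of "\<lambda>a. g a * d k x a"] less.prems(1) by (simp add: dk')
      have "even (\<Sum>a\<in>C - {e'}. d k x a)" for x
      proof -
        \<comment> \<open>Merging would preserve the total exactly if \<open>e'\<close> were counted
          with sign \<open>s\<close>; as \<open>s\<close> is 1 or -1, the discrepancy is
          even.\<close>
        have "(\<Sum>a\<in>C - {e'}. d k x a) = (\<Sum>a\<in>C. d h x a) - (d h x e' - s * d h x e')"
          using split[of "\<lambda>_. 1" x] split'[of "\<lambda>_. 1" x] dk[of x]
          unfolding mult_1 by linarith
        moreover have "even (d h x e' - s * d h x e')" by (auto simp: s_def)
        ultimately show ?thesis using even_d[of x] by simp
      qed
      moreover have "card (C - {e'}) < card C"
        using e' less.prems(1) by (meson card_Diff1_less)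
      ultimately obtain f :: "'e \<Rightarrow> int" where f: "\<forall>a\<in>C - {e'}. \<bar>f a\<bar> = 1"
        "\<And>x. (\<Sum>a\<in>C - {e'}. f a * d k x a) = 0"
        using less.hyps[of "C - {e'}" k] less.prems(1) unfolding d_def by auto
      \<comment> \<open>The flow along the merged edge runs through \<open>e\<close> and then
        \<open>e'\<close>; \<open>s\<close> corrects for the direction of \<open>e'\<close>.\<close>
      define g where "g = f(e' := s * f e)"
      have "(\<Sum>a\<in>C. g a * d h x a) = 0" for x
      proof -
        have "(\<Sum>a\<in>C - {e'} - {e}. g a * d h x a) = (\<Sum>a\<in>C - {e'} - {e}. f a * d h x a)"
          by (rule sum.cong) (auto simp: g_def)
        then have "(\<Sum>a\<in>C. g a * d h x a) =
            f e * (d h x e + s * d h x e') + (\<Sum>a\<in>C - {e'} - {e}. f a * d h x a)"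
          using e'(2) unfolding split by (simp add: g_def ring_distribs)
        also have "\<dots> = 0" using f(2)[of x] unfolding split' dk .
        finally show ?thesis .
      qed
      moreover have "\<forall>a\<in>C. \<bar>g a\<bar> = 1" using f(1) eC abs_s by (auto simp: g_def abs_mult)
      ultimately show ?thesis unfolding d_def by blast
    qed
  qed simp
qed

section \<open>Covering a finite set by two subsets with even traces\<close>

text \<open>If \<open>P\<close> itself has the wanted parity, it serves twice. Otherwise removing
  one element corrects the parity, and removing different elements from the two copies keeps
  \<open>P\<close> covered.\<close>

lemma two_subset_cover_parity:
  assumes "finite P" "even (card P) = p \<or> card P \<ge> 2"
  shows "\<exists>A B. A \<union> B = P \<and> even (card A) = p \<and> even (card B) = p"
proof (cases "even (card P) = p")
  case False
  with assms have "card P \<ge> 2" by blast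
  then obtain x y where xy: "x \<in> P" "y \<in> P" "x \<noteq> y"
    using card_le_Suc0_iff_eq[OF assms(1)] by fastforce
  then have "P - {x} \<union> (P - {y}) = P" by blast
  moreover have "even (card (P - {x})) = p" "even (card (P - {y})) = p"
    using False xy assms(1) \<open>card P \<ge> 2\<close> by auto
  ultimately show ?thesis by blast
qed blast

text \<open>Each of \<open>X\<close>, \<open>Y\<close> and their symmetric difference is a disjoint
  union of two of the three regions \<open>P\<close>, \<open>Q\<close>, \<open>R\<close>. Hence a
  set meeting all three regions in the same parity \<open>p\<close> meets each of the given sets
  evenly.\<close>

lemma even_cover_of_two_sets:
  fixes U :: "'a set"
  assumes "finite U" "X \<subseteq> U" "Y \<subseteq> U"
    and "card X \<noteq> 1" "card Y \<noteq> 1" "card (sym_diff X Y) \<noteq> 1"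
  shows "\<exists>A B. A \<union> B = U \<and> (\<forall>Z\<in>{X, Y, sym_diff X Y}.
    even (card (A \<inter> Z)) \<and> even (card (B \<inter> Z)))"
proof -
  define P where "P = X - Y"
  define Q where "Q = Y - X"
  define R where "R = X \<inter> Y"
  have fin: "finite P" "finite Q" "finite R" "finite X" "finite Y"
    using assms(1-3) by (auto simp: P_def Q_def R_def intro: finite_subset)
  have cards: "card X = card P + card R" "card Y = card Q + card R"
    "card (sym_diff X Y) = card P + card Q"
    unfolding P_def Q_def R_def
    using fin(4,5) card_Int_Diff[of X Y] card_Int_Diff[of Y X]
    by (simp_all add: Int_commute add.commute card_Un_disjoint Diff_Int_distrib)
  \<comment> \<open>If some region is empty, even parity is forced, and the cardinality hypotheses
    then forbid regions of size 1. If none is empty, odd parity works, since regions of size 1 are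
    harmless.\<close>
  define p where "p \<longleftrightarrow> card P = 0 \<or> card Q = 0 \<or> card R = 0"
  have parity: "even c = p \<or> c \<ge> 2" if "p \<Longrightarrow> c \<noteq> 1" "\<not> p \<Longrightarrow> c \<noteq> 0" for c :: nat
  proof (cases "c = 0 \<or> c = 1")
    case True
    then show ?thesis using that by (cases p) auto
  qed simp
  have "even (card P) = p \<or> card P \<ge> 2" "even (card Q) = p \<or> card Q \<ge> 2"
    "even (card R) = p \<or> card R \<ge> 2"
    using assms(4-6) unfolding cards by (intro parity; auto simp: p_def)+
  note covers = this[THEN two_subset_cover_parity[rotated]]
  obtain A1 B1 where 1: "A1 \<union> B1 = P" "even (card A1) = p" "even (card B1) = p"
    using covers(1) fin(1) by blast
  obtain A2 B2 where 2: "A2 \<union> B2 = Q" "even (card A2) = p" "even (card B2) = p"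
    using covers(2) fin(2) by blast
  obtain A3 B3 where 3: "A3 \<union> B3 = R" "even (card A3) = p" "even (card B3) = p"
    using covers(3) fin(3) by blast
  \<comment> \<open>Elements outside \<open>X\<close> and \<open>Y\<close> affect no parity, so they
    go into both covering sets.\<close>
  define W where "W = U - (X \<union> Y)"
  have *: "even (card ((T1 \<union> T2 \<union> T3 \<union> W) \<inter> Z))"
    if "T1 \<subseteq> P" "T2 \<subseteq> Q" "T3 \<subseteq> R"
      "even (card T1) = p" "even (card T2) = p" "even (card T3) = p"
      "Z \<in> {X, Y, sym_diff X Y}" for T1 T2 T3 Z
  proof -
    have T: "finite T1" "finite T2" "finite T3"
      using that(1-3) fin(1-3) by (auto intro: finite_subset)
    have "(T1 \<union> T2 \<union> T3 \<union> W) \<inter> X = T1 \<union> T3" "(T1 \<union> T2 \<union> T3 \<union> W) \<inter> Y = T2 \<union> T3"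
      "(T1 \<union> T2 \<union> T3 \<union> W) \<inter> sym_diff X Y = T1 \<union> T2"
      using that(1-3) by (auto simp: P_def Q_def R_def W_def)
    moreover have "T1 \<inter> T3 = {}" "T2 \<inter> T3 = {}" "T1 \<inter> T2 = {}"
      using that(1-3) by (auto simp: P_def Q_def R_def)
    moreover have "even (card (T \<union> T'))"
      if "finite T" "finite T'" "T \<inter> T' = {}" "even (card T) = p" "even (card T') = p" for T T' :: "'a set"
      using that by (auto simp: card_Un_disjoint)
    ultimately show ?thesis
      using that(4-7) T by auto
  qed
  have "(A1 \<union> A2 \<union> A3 \<union> W) \<union> (B1 \<union> B2 \<union> B3 \<union> W) = (A1 \<union> B1) \<union> (A2 \<union> B2) \<union> (A3 \<union> B3) \<union> W"
    by (simp only: Un_ac Un_absorb Un_left_absorb)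
  also have "\<dots> = U"
    unfolding 1 2 3 using assms(2,3) by (auto simp: P_def Q_def R_def W_def)
  finally have U: "(A1 \<union> A2 \<union> A3 \<union> W) \<union> (B1 \<union> B2 \<union> B3 \<union> W) = U" .
  have "\<forall>Z\<in>{X, Y, sym_diff X Y}. even (card ((A1 \<union> A2 \<union> A3 \<union> W) \<inter> Z)) \<and>
      even (card ((B1 \<union> B2 \<union> B3 \<union> W) \<inter> Z))"
    by (intro ballI conjI *) (use 1 2 3 in auto)
  with U show ?thesis by blast
qed

text \<open>The hypothesis \<open>rank\<close> expresses that any three members of \<open>M\<close>
  are linearly dependent over \<open>F_2\<close>. So \<open>M\<close> lies in the span of two sets,
  and the cover for these two works for all of \<open>M\<close>.\<close>

lemma even_cover_of_rank_two_family:
  assumes "finite U" "M \<subseteq> Pow U" "\<And>X. X \<in> M \<Longrightarrow> card X \<noteq> 1"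
    and sd: "\<And>X Y. X \<in> M \<Longrightarrow> Y \<in> M \<Longrightarrow> sym_diff X Y \<in> M"
    and rank: "\<And>X Y Z. X \<in> M \<Longrightarrow> Y \<in> M \<Longrightarrow> Z \<in> M \<Longrightarrow>
      X = {} \<or> Y = {} \<or> X = Y \<or> Z \<in> {{}, X, Y, sym_diff X Y}"
  shows "\<exists>A B. A \<union> B = U \<and> (\<forall>Z\<in>M. even (card (A \<inter> Z)) \<and> even (card (B \<inter> Z)))"
proof -
  have "\<exists>X Y. X \<subseteq> U \<and> Y \<subseteq> U \<and> card X \<noteq> 1 \<and> card Y \<noteq> 1 \<and> card (sym_diff X Y) \<noteq> 1 \<and>
      M \<subseteq> {{}, X, Y, sym_diff X Y}"
  proof (cases "\<exists>X\<in>M. \<exists>Y\<in>M. X \<noteq> {} \<and> Y \<noteq> {} \<and> X \<noteq> Y")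
    case True
    then obtain X Y where XY: "X \<in> M" "Y \<in> M" "X \<noteq> {}" "Y \<noteq> {}" "X \<noteq> Y" by blast
    then have "M \<subseteq> {{}, X, Y, sym_diff X Y}" using rank[OF XY(1,2)] by blast
    moreover have "X \<subseteq> U" "Y \<subseteq> U" using XY assms(2) by auto
    ultimately show ?thesis using XY assms(3) sd by (intro exI[of _ X] exI[of _ Y]) simp
  next
    case False
    then have "\<exists>X. X \<subseteq> U \<and> card X \<noteq> 1 \<and> M \<subseteq> {{}, X}"
    proof (cases "M \<subseteq> {{}}")
      case False
      then obtain X where "X \<in> M" "X \<noteq> {}" by blast
      with \<open>\<not> (\<exists>X\<in>M. \<exists>Y\<in>M. X \<noteq> {} \<and> Y \<noteq> {} \<and> X \<noteq> Y)\<close> show ?thesis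
        using assms(2,3) by (intro exI[of _ X]) auto
    qed (auto intro!: exI[of _ "{}"])
    then obtain X where "X \<subseteq> U" "card X \<noteq> 1" "M \<subseteq> {{}, X}" by blast
    \<comment> \<open>\<open>X\<close> is used for both sets; its symmetric difference with itself
      is empty.\<close>
    then show ?thesis by (intro exI[of _ X]) auto
  qed
  then obtain X Y where XY: "X \<subseteq> U" "Y \<subseteq> U" "card X \<noteq> 1" "card Y \<noteq> 1"
    "card (sym_diff X Y) \<noteq> 1" and M: "M \<subseteq> {{}, X, Y, sym_diff X Y}"
    by (elim exE conjE) (rule that)
  obtain A B where AB: "A \<union> B = U" "\<forall>Z\<in>{X, Y, sym_diff X Y}.
      even (card (A \<inter> Z)) \<and> even (card (B \<inter> Z))"
    using even_cover_of_two_sets[OF assms(1) XY] by (elim exE conjE) (rule that)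
  have "even (card (A \<inter> Z)) \<and> even (card (B \<inter> Z))" if "Z \<in> M" for Z
  proof (cases "Z = {}")
    case False
    then have "Z \<in> {X, Y, sym_diff X Y}" using subsetD[OF M that] by (simp only: insert_iff simp_thms)
    with AB(2) show ?thesis by (rule bspec)
  qed simp
  with AB(1) show ?thesis by (intro exI[of _ A] exI[of _ B]) simp
qed


section \<open>Rational linear relations and their integer multiples\<close>

text \<open>Clearing denominators and dividing by the gcd leaves coprime integers, which cannot all
  be even. The nonzero value at \<open>v\<close> makes the gcd nonzero.\<close>

lemma odd_integer_multiple:
  fixes q :: "'a \<Rightarrow> rat"
  assumes "finite A" "v \<in> A" "q v \<noteq> 0"
  shows "\<exists>(c :: 'a \<Rightarrow> int) r. (\<forall>a\<in>A. of_int (c a) = r * q a) \<and> (\<exists>a\<in>A. odd (c a))"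
proof -
  have "\<exists>m::int. m \<noteq> 0 \<and> (\<forall>a\<in>A. of_int m * q a \<in> \<int>)"
    using assms(1)
  proof induction
    case (insert x A)
    then obtain m :: int where m: "m \<noteq> 0" "\<forall>a\<in>A. of_int m * q a \<in> \<int>" by blast
    obtain k l :: int where kl: "q x = of_int k / of_int l" "l \<noteq> 0"
      by (metis Rat_cases Fract_of_int_quotient less_irrefl)
    have "of_int (m * l) * q x = of_int (m * k)" using kl by simp
    moreover have "of_int (m * l) * q a \<in> \<int>" if "a \<in> A" for a
      using m(2) that Ints_mult[of "of_int l" "of_int m * q a"] by (simp add: ac_simps)
    ultimately have "\<forall>a\<in>insert x A. of_int (m * l) * q a \<in> \<int>"
      by (metis Ints_of_int insert_iff)
    with m(1) kl(2) show ?case by (intro exI[of _ "m * l"]) simp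
  qed (auto intro: exI[of _ 1])
  then obtain m :: int where m: "m \<noteq> 0" "\<forall>a\<in>A. of_int m * q a \<in> \<int>" by blast
  define c where "c a = \<lfloor>of_int m * q a\<rfloor>" for a
  have c: "of_int (c a) = of_int m * q a" if "a \<in> A" for a
    using m(2) that by (auto simp: c_def elim: Ints_cases)
  define g where "g = Gcd (c ` A)"
  have "c v \<noteq> 0" using c[OF assms(2)] m(1) assms(3) by auto
  then have g: "g \<noteq> 0" using assms(2) by (auto simp: g_def Gcd_0_iff)
  have dvd: "g dvd c a" if "a \<in> A" for a using that by (simp add: g_def Gcd_dvd)
  have "of_int (c a div g) = (of_int m / of_int g) * q a" if "a \<in> A" for a
    using dvd[OF that] g by (simp add: c[OF that, symmetric] field_simps flip: of_int_mult)
  moreover have "\<exists>a\<in>A. odd (c a div g)"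
  proof (rule ccontr)
    assume "\<not> ?thesis"
    then have "2 * g dvd c a" if "a \<in> A" for a
      using dvd[OF that] that g by (metis dvd_div_iff_mult mult.commute)
    then have "2 * g dvd g" unfolding g_def by (intro Gcd_greatest) auto
    then show False using dvd_times_right_cancel_iff[of g 2 1] g by simp
  qed
  ultimately show ?thesis
    by (intro exI[of _ "\<lambda>a. c a div g"] exI[of _ "of_int m / of_int g"]) simp
qed

text \<open>More vectors than the dimension of the span are dependent within it, hence also in the
  ambient space. The relation is stated by coordinates so that it can be reduced modulo 2.\<close>

lemma (in vec_space) nontrivial_relation_of_dim_span_less:
  assumes "finite A" "A \<subseteq> carrier_vec n" "finite B" "B \<subseteq> span A"
    and "vectorspace.dim class_ring (vs (span A)) < card B"
  shows "\<exists>a. (\<exists>v\<in>B. a v \<noteq> 0) \<and> (\<forall>i<n. (\<Sum>v\<in>B. a v * vec_index v i) = 0)"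
proof -
  have sub: "subspace class_ring (span A) V" using assms(2) by (intro span_is_subspace) simp
  interpret W: vectorspace class_ring "vs (span A)" using sub by (rule subspace_is_vs)
  have "W.fin_dim" using assms(1,2) by (intro fin_dim_span) auto
  then have "W.lin_dep B"
    using W.li_le_dim(2)[of B] assms(4,5) by auto
  moreover have "submodule class_ring (span A) V" using sub by (simp add: subspace_def)
  ultimately have "lin_dep B"
    using span_li_not_depend(2)[OF assms(4)] by simp
  then obtain B' a v where B': "finite B'" "B' \<subseteq> B" "lincomb a B' = 0\<^sub>v n" "v \<in> B'" "a v \<noteq> 0"
    unfolding lin_dep_def by auto
  have carr: "B' \<subseteq> carrier_vec n"
    using B'(2) assms(2,4) span_is_subset2[of A] by auto
  \<comment> \<open>Dependence supplies coefficients on a subset \<open>B'\<close> only; they are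
    extended by 0 to \<open>B\<close>.\<close>
  have "(\<Sum>v\<in>B. (if v \<in> B' then a v else 0) * vec_index v i) = 0" if "i < n" for i
  proof -
    have "(\<Sum>v\<in>B. (if v \<in> B' then a v else 0) * vec_index v i) = (\<Sum>v\<in>B'. a v * vec_index v i)"
      by (rule sum.mono_neutral_cong_right) (use assms(3) B'(2) in auto)
    also have "\<dots> = vec_index (lincomb a B') i" using lincomb_index[OF that carr] by simp
    finally show ?thesis using that B'(3) by simp
  qed
  with B'(2,4,5) show ?thesis
    by (intro exI[of _ "\<lambda>v. if v \<in> B' then a v else 0"]) auto
qed


section \<open>Parities of the integer vectors in a rational span\<close>

text \<open>The reduction of \<open>x\<close> modulo 2, encoded as a set of indices so that addition
  becomes symmetric difference.\<close>

definition odd_support :: "int Matrix.vec \<Rightarrow> nat set" where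
  "odd_support x = {i. i < dim_vec x \<and> odd (vec_index x i)}"

lemma odd_support_add:
  assumes "x \<in> carrier_vec n" "y \<in> carrier_vec n"
  shows "odd_support (x + y) = sym_diff (odd_support x) (odd_support y)"
  using assms by (auto simp: odd_support_def)

text \<open>The truth values \<open>p\<close>, \<open>q\<close>, \<open>r\<close> act as
  coefficients in \<open>F_2\<close> of a nontrivial relation \<open>pX + qY + rZ = 0\<close>. If
  \<open>r\<close> holds, the relation can be solved for \<open>Z\<close>; otherwise it relates
  \<open>X\<close> and \<open>Y\<close> alone.\<close>

lemma dependent_triple_of_sets:
  assumes "\<And>i. (p \<and> i \<in> X) \<longleftrightarrow> ((q \<and> i \<in> Y) \<noteq> (r \<and> i \<in> Z))" and "p \<or> q \<or> r"
  shows "X = {} \<or> Y = {} \<or> X = Y \<or> Z \<in> {{}, X, Y, sym_diff X Y}"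
proof (cases r)
  case True
  have "Z = {i. (p \<and> i \<in> X) \<noteq> (q \<and> i \<in> Y)}" using assms(1) True by blast
  then show ?thesis by (cases p; cases q) (simp_all, blast)
next
  case False
  then have eq: "(p \<and> i \<in> X) \<longleftrightarrow> (q \<and> i \<in> Y)" for i using assms(1) by blast
  show ?thesis
  proof (cases "p \<and> q")
    case True
    with eq have "X = Y" by blast
    then show ?thesis by simp
  next
    case False
    with eq assms(2) \<open>\<not> r\<close> have "X = {} \<or> Y = {}" by blast
    then show ?thesis by (elim disjE) simp_all
  qed
qed

text \<open>A rational relation between the three vectors, scaled to integers that are not all even,
  stays nontrivial modulo 2.\<close>

lemma odd_support_of_dependent_triple:
  fixes x y z :: "int Matrix.vec"
  assumes A: "finite A" "A \<subseteq> carrier_vec n"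
    and dim: "vectorspace.dim class_ring ((module_vec TYPE(rat) n)\<lparr>carrier := S\<rparr>) \<le> 2"
    and S: "S = LinearCombinations.module.span class_ring (module_vec TYPE(rat) n) A"
    and x: "x \<in> carrier_vec n" "map_vec rat_of_int x \<in> S"
    and y: "y \<in> carrier_vec n" "map_vec rat_of_int y \<in> S"
    and z: "z \<in> carrier_vec n" "map_vec rat_of_int z \<in> S"
  shows "odd_support x = {} \<or> odd_support y = {} \<or> odd_support x = odd_support y \<or>
    odd_support z \<in> {{}, odd_support x, odd_support y, sym_diff (odd_support x) (odd_support y)}"
proof (rule ccontr)
  assume contra: "\<not> ?thesis"
  let ?r = "map_vec rat_of_int"
  \<comment> \<open>Coinciding vectors have the same odd support, which already gives the
    conclusion. So \<open>?B\<close> has three elements, exceeding the dimension, and coefficients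
    can be indexed by the vectors themselves.\<close>
  have "x \<noteq> y" "x \<noteq> z" "y \<noteq> z" using contra by auto
  moreover have inj: "inj ?r"
    by (rule injI) (auto simp: vec_eq_iff map_vec_def)
  ultimately have distinct: "?r x \<noteq> ?r y" "?r x \<noteq> ?r z" "?r y \<noteq> ?r z"
    by (simp_all add: inj_eq)
  let ?B = "{?r x, ?r y, ?r z}"
  have "card ?B = 3" using distinct by simp
  then obtain a where a: "\<exists>v\<in>?B. a v \<noteq> 0" "\<forall>i<n. (\<Sum>v\<in>?B. a v * vec_index v i) = 0"
    using vec_space.nontrivial_relation_of_dim_span_less[OF A, of ?B] x(2) y(2) z(2) dim
    unfolding S by auto
  then obtain c :: "rat Matrix.vec \<Rightarrow> int" and r where
    c: "\<forall>v\<in>?B. of_int (c v) = r * a v" "\<exists>v\<in>?B. odd (c v)"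
    using odd_integer_multiple[of ?B _ a] by blast
  have "c (?r x) * vec_index x i + c (?r y) * vec_index y i + c (?r z) * vec_index z i = 0"
    if "i < n" for i
  proof -
    have "rat_of_int (c (?r x) * vec_index x i + c (?r y) * vec_index y i + c (?r z) * vec_index z i)
        = r * (\<Sum>v\<in>?B. a v * vec_index v i)"
      using distinct that x(1) y(1) z(1) c(1) by (simp add: algebra_simps)
    also have "\<dots> = 0" using a(2) that by simp
    finally show ?thesis by (simp only: of_int_eq_0_iff)
  qed
  then have "even (c (?r x) * vec_index x i + c (?r y) * vec_index y i + c (?r z) * vec_index z i)"
    if "i < n" for i using that by simp
  then have parity: "(odd (c (?r x)) \<and> odd (vec_index x i)) \<longleftrightarrow>
      ((odd (c (?r y)) \<and> odd (vec_index y i)) \<noteq> (odd (c (?r z)) \<and> odd (vec_index z i)))"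
    if "i < n" for i
    using that unfolding even_add even_mult_iff by meson
  have "(odd (c (?r x)) \<and> i \<in> odd_support x) \<longleftrightarrow>
      ((odd (c (?r y)) \<and> i \<in> odd_support y) \<noteq> (odd (c (?r z)) \<and> i \<in> odd_support z))" for i
  proof (cases "i < n")
    case True
    then show ?thesis using parity[OF True] x(1) y(1) z(1) by (simp add: odd_support_def)
  next
    case False
    then show ?thesis using x(1) y(1) z(1) by (simp add: odd_support_def)
  qed
  moreover have "odd (c (?r x)) \<or> odd (c (?r y)) \<or> odd (c (?r z))" using c(2) by simp
  ultimately show False by (rule notE[OF contra dependent_triple_of_sets])
qed

text \<open>The integer vectors in \<open>S\<close> are closed under addition, so their odd supports
  are closed under symmetric difference. The rank bound makes any three of these dependent, and
  \<open>odd_coordinate_free\<close> says that none is a singleton.\<close>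

lemma even_cover_of_rank_two_span:
  assumes A: "finite A" "A \<subseteq> carrier_vec n"
    and S: "S = LinearCombinations.module.span class_ring (module_vec TYPE(rat) n) A"
    and rank: "rank_Q n S \<le> 2"
    and free: "odd_coordinate_free n S"
  shows "\<exists>P Q. P \<union> Q = {..<n} \<and> (\<forall>x\<in>carrier_vec n. map_vec rat_of_int x \<in> S \<longrightarrow>
    even (card (P \<inter> odd_support x)) \<and> even (card (Q \<inter> odd_support x)))"
proof -
  interpret vec_space "TYPE(rat)" n .
  define L where "L = {x :: int Matrix.vec. x \<in> carrier_vec n \<and> map_vec rat_of_int x \<in> S}"
  have add: "x + y \<in> L" if "x \<in> L" "y \<in> L" for x y
  proof -
    have "map_vec rat_of_int (x + y) = map_vec rat_of_int x + map_vec rat_of_int y"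
      using that by (auto simp: L_def)
    moreover have "map_vec rat_of_int x + map_vec rat_of_int y \<in> S"
      using span_add1[of A] that A(2) by (simp add: L_def S)
    ultimately show ?thesis using that by (simp add: L_def)
  qed
  have "\<exists>P Q. P \<union> Q = {..<n} \<and> (\<forall>Z\<in>odd_support ` L.
      even (card (P \<inter> Z)) \<and> even (card (Q \<inter> Z)))"
  proof (rule even_cover_of_rank_two_family)
    show "odd_support ` L \<subseteq> Pow {..<n}" by (auto simp: L_def odd_support_def)
    show "card X \<noteq> 1" if "X \<in> odd_support ` L" for X
      using that free by (auto simp: L_def odd_coordinate_free_def odd_support_def)
    show "sym_diff X Y \<in> odd_support ` L" if XY: "X \<in> odd_support ` L" "Y \<in> odd_support ` L" for X Y
    proof -
      obtain x y where "x \<in> L" "X = odd_support x" "y \<in> L" "Y = odd_support y"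
        using XY by blast
      moreover from this have "odd_support (x + y) = sym_diff X Y"
        by (auto simp: L_def odd_support_add)
      ultimately show ?thesis using add[of x y] by (metis imageI)
    qed
    show "X = {} \<or> Y = {} \<or> X = Y \<or> Z \<in> {{}, X, Y, sym_diff X Y}"
      if XYZ: "X \<in> odd_support ` L" "Y \<in> odd_support ` L" "Z \<in> odd_support ` L" for X Y Z
    proof -
      obtain x y z where "x \<in> L" "X = odd_support x" "y \<in> L" "Y = odd_support y"
        "z \<in> L" "Z = odd_support z" using XYZ by blast
      then show ?thesis
        using odd_support_of_dependent_triple[OF A rank[unfolded rank_Q_def] S, of x y z]
        by (simp only: L_def mem_Collect_eq)
    qed
  qed simp
  then show ?thesis by (simp add: L_def) (simp add: Ball_def imp_conjL)
qed

section \<open>From parities of edge classes to a 4-flow\<close>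

text \<open>An entry of the oriented incidence matrix. At a loop the two terms cancel, in agreement
  with \<open>E_plus\<close> and \<open>E_minus\<close>, which omit loops.\<close>

definition incidence :: "('v, 'e) pre_digraph \<Rightarrow> 'v \<Rightarrow> 'e \<Rightarrow> int" where
  "incidence D v e = of_bool (tail D e = v) - of_bool (head D e = v)"

lemma sum_mult_incidence:
  assumes "finite (arcs D)"
  shows "(\<Sum>e\<in>arcs D. f e * incidence D v e) = (\<Sum>e\<in>E_plus D v. f e) - (\<Sum>e\<in>E_minus D v. f e)"
proof -
  have "(\<Sum>e\<in>arcs D. f e * incidence D v e) =
      (\<Sum>e\<in>arcs D. (if e \<in> E_plus D v then f e else 0) - (if e \<in> E_minus D v then f e else 0))"
    by (rule sum.cong) (auto simp: incidence_def E_plus_def E_minus_def)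
  also have "\<dots> = (\<Sum>e\<in>arcs D \<inter> E_plus D v. f e) - (\<Sum>e\<in>arcs D \<inter> E_minus D v. f e)"
    using assms by (simp add: sum_subtractf sum.inter_restrict)
  also have "arcs D \<inter> E_plus D v = E_plus D v" by (auto simp: E_plus_def)
  also have "arcs D \<inter> E_minus D v = E_minus D v" by (auto simp: E_minus_def)
  finally show ?thesis .
qed

lemma conserved_iff_sum_incidence:
  fixes f :: "'e \<Rightarrow> int"
  assumes "finite (arcs D)"
  shows "conserved D f \<longleftrightarrow> (\<forall>v\<in>verts D. (\<Sum>e\<in>arcs D. f e * incidence D v e) = 0)"
  by (simp add: conserved_def sum_mult_incidence[OF assms])

lemma eps_eq_sum_incidence:
  assumes "finite (arcs D)" "i < length us"
  shows "vec_index (eps D \<phi> us v) i = (\<Sum>e\<in>edge_class D \<phi> us i. incidence D v e)"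
proof -
  have fin: "finite (E_plus D v)" "finite (E_minus D v)"
    using assms(1) by (auto simp: E_plus_def E_minus_def)
  have "(\<Sum>e\<in>edge_class D \<phi> us i. incidence D v e) =
      (\<Sum>e\<in>arcs D. of_bool (e \<in> edge_class D \<phi> us i) * incidence D v e)"
    using assms(1) by (intro sum.mono_neutral_cong_left) (auto simp: edge_class_def)
  also have "\<dots> = int (card (E_plus D v \<inter> edge_class D \<phi> us i))
        - int (card (E_minus D v \<inter> edge_class D \<phi> us i))"
    using fin by (simp add: sum_mult_incidence[OF assms(1)])
  finally show ?thesis using assms(2) by (simp add: eps_def)
qed

text \<open>Distinctness of \<open>us\<close> makes the classes disjoint, so the sum splits into the
  coordinates of \<open>eps\<close> indexed by \<open>P\<close>, and its parity is that of the
  number of odd ones.\<close>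

lemma even_sum_incidence_edge_classes:
  assumes "finite (arcs D)" "distinct us" "P \<subseteq> {..<length us}"
    and "even (card (P \<inter> odd_support (eps D \<phi> us v)))"
  shows "even (\<Sum>e\<in>(\<Union>i\<in>P. edge_class D \<phi> us i). incidence D v e)"
proof -
  have P: "finite P" using assms(3) finite_subset by blast
  have "(\<Sum>e\<in>(\<Union>i\<in>P. edge_class D \<phi> us i). incidence D v e) =
      (\<Sum>i\<in>P. \<Sum>e\<in>edge_class D \<phi> us i. incidence D v e)"
  proof (rule sum.UNION_disjoint[OF P])
    show "\<forall>i\<in>P. finite (edge_class D \<phi> us i)" using assms(1) by (simp add: edge_class_def)
    show "\<forall>i\<in>P. \<forall>j\<in>P. i \<noteq> j \<longrightarrow> edge_class D \<phi> us i \<inter> edge_class D \<phi> us j = {}"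
      using assms(2,3) by (auto simp: edge_class_def nth_eq_iff_index_eq subset_iff)
  qed
  also have "\<dots> = (\<Sum>i\<in>P. vec_index (eps D \<phi> us v) i)"
    using assms(3) by (intro sum.cong) (auto simp: eps_eq_sum_incidence[OF assms(1)])
  also have "even \<dots> \<longleftrightarrow> even (card {i \<in> P. odd (vec_index (eps D \<phi> us v) i)})"
    by (rule even_sum_iff[OF P])
  also have "{i \<in> P. odd (vec_index (eps D \<phi> us v) i)} = P \<inter> odd_support (eps D \<phi> us v)"
    using assms(3) by (auto simp: odd_support_def eps_def)
  finally show ?thesis using assms(4) by simp
qed

lemma admits_4_flow_of_even_cover:
  assumes "finite_multigraph G" "orientation_of D G" "C1 \<union> C2 = arcs D"
    and even: "\<forall>v\<in>verts D. even (\<Sum>e\<in>C1. incidence D v e)"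
      "\<forall>v\<in>verts D. even (\<Sum>e\<in>C2. incidence D v e)"
  shows "admits_flow 4 G"
proof -
  have fin: "finite (arcs D)" and arcs: "arcs D = edges G"
    using assms(1,2) by (auto simp: finite_multigraph_def orientation_of_def)
  \<comment> \<open>The signing lemma asks for evenness at every element of the vertex type; outside
    the graph all incidences vanish.\<close>
  have outside: "incidence D v e = 0" if "v \<notin> verts D" "e \<in> arcs D" for v e
  proof -
    have "{tail D e, head D e} \<subseteq> verts D"
      using assms(1,2) that(2) by (simp add: finite_multigraph_def orientation_of_def)
    with that(1) show ?thesis by (auto simp: incidence_def)
  qed
  have flow: "\<exists>f :: _ \<Rightarrow> int. (\<forall>e\<in>C. \<bar>f e\<bar> = 1) \<and> (\<forall>e. e \<notin> C \<longrightarrow> f e = 0) \<and>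
      (\<forall>v. (\<Sum>e\<in>arcs D. f e * incidence D v e) = 0)"
    if C: "C \<subseteq> arcs D" and ev: "\<forall>v\<in>verts D. even (\<Sum>e\<in>C. incidence D v e)" for C
  proof -
    have "even (\<Sum>e\<in>C. incidence D v e)" for v
    proof (cases "v \<in> verts D")
      case False
      then have "(\<Sum>e\<in>C. incidence D v e) = 0" using outside C by (intro sum.neutral) auto
      then show ?thesis by simp
    qed (use ev in blast)
    then obtain f :: "_ \<Rightarrow> int" where f: "\<forall>e\<in>C. \<bar>f e\<bar> = 1"
      "\<And>v. (\<Sum>e\<in>C. f e * incidence D v e) = 0"
      using even_set_nowhere_zero_signing[OF finite_subset[OF C fin], of "tail D" "head D"]
      unfolding incidence_def by blast
    have "(\<Sum>e\<in>arcs D. (if e \<in> C then f e else 0) * incidence D v e) = 0" for v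
    proof -
      have "(\<Sum>e\<in>arcs D. (if e \<in> C then f e else 0) * incidence D v e) =
          (\<Sum>e\<in>C. f e * incidence D v e)"
        using C fin by (intro sum.mono_neutral_cong_right) auto
      then show ?thesis by (simp add: f(2))
    qed
    then show ?thesis using f(1) by (intro exI[of _ "\<lambda>e. if e \<in> C then f e else 0"]) simp
  qed
  have sub: "C1 \<subseteq> arcs D" "C2 \<subseteq> arcs D" using assms(3) by auto
  obtain f1 :: "_ \<Rightarrow> int" where f1: "\<forall>e\<in>C1. \<bar>f1 e\<bar> = 1" "\<forall>e. e \<notin> C1 \<longrightarrow> f1 e = 0"
    "\<forall>v. (\<Sum>e\<in>arcs D. f1 e * incidence D v e) = 0"
    using flow[OF sub(1) even(1)] by (elim exE conjE) (rule that)
  obtain f2 :: "_ \<Rightarrow> int" where f2: "\<forall>e\<in>C2. \<bar>f2 e\<bar> = 1" "\<forall>e. e \<notin> C2 \<longrightarrow> f2 e = 0"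
    "\<forall>v. (\<Sum>e\<in>arcs D. f2 e * incidence D v e) = 0"
    using flow[OF sub(2) even(2)] by (elim exE conjE) (rule that)
  define \<psi> where "\<psi> e = f1 e + 2 * f2 e" for e
  have "conserved D \<psi>"
    using f1(3) f2(3) by (simp add: conserved_iff_sum_incidence[OF fin] \<psi>_def distrib_right
        sum.distrib mult.assoc flip: sum_distrib_left)
  moreover have "0 < \<bar>\<psi> e\<bar> \<and> \<bar>\<psi> e\<bar> < 4" if "e \<in> edges G" for e
  proof -
    have "\<bar>f1 e\<bar> = 1 \<or> f1 e = 0" "\<bar>f2 e\<bar> = 1 \<or> f2 e = 0" "\<bar>f1 e\<bar> = 1 \<or> \<bar>f2 e\<bar> = 1"
      using f1(1,2) f2(1,2) that assms(3) unfolding arcs by blast+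
    \<comment> \<open>If \<open>f1 e\<close> is 1 or -1, then \<open>\<psi> e\<close> is odd of
      absolute value at most 3; otherwise \<open>f2 e\<close> is 1 or -1 and \<open>\<psi> e\<close>
      is 2 or -2.\<close>
    then show ?thesis unfolding \<psi>_def by arith
  qed
  ultimately show ?thesis using assms(2) unfolding admits_flow_def by blast
qed

theorem theorem1p7:
  fixes G :: "('v, 'e) multigraph"
    and D :: "('v, 'e) pre_digraph"
    and \<phi> :: "'e \<Rightarrow> real ^ 3"
    and us :: "(real ^ 3) list"
  assumes "finite_multigraph G"
    and "orientation_of D G"
    and "S2_flow D \<phi>"
    and "distinct us" and "set us = \<phi> ` arcs D"
    and "odd_coordinate_free (length us) (S_Q D \<phi> us)"
    and "rank_Q (length us) (S_Q D \<phi> us) \<le> 2"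
  shows "admits_flow 4 G"
proof -
  have finite_D: "finite (verts D)" "finite (arcs D)"
    using assms(1,2) by (auto simp: finite_multigraph_def orientation_of_def)
  define A where "A = (\<lambda>v. map_vec rat_of_int (eps D \<phi> us v)) ` verts D"
  interpret vec_space "TYPE(rat)" "length us" .
  have eps: "eps D \<phi> us v \<in> carrier_vec (length us)" for v by (simp add: eps_def)
  have A: "finite A" "A \<subseteq> carrier_vec (length us)" using finite_D(1) eps by (auto simp: A_def)
  have S: "S_Q D \<phi> us = span A" by (simp add: S_Q_def A_def)
  obtain P Q where PQ: "P \<union> Q = {..<length us}" and
    even: "\<forall>x\<in>carrier_vec (length us). map_vec rat_of_int x \<in> S_Q D \<phi> us \<longrightarrow>
      even (card (P \<inter> odd_support x)) \<and> even (card (Q \<inter> odd_support x))"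
    using even_cover_of_rank_two_span[OF A S assms(7,6)] by (elim exE conjE) (rule that)
  have "map_vec rat_of_int (eps D \<phi> us v) \<in> S_Q D \<phi> us" if "v \<in> verts D" for v
    using in_own_span[of A] A(2) that by (auto simp: S A_def)
  note even_eps = even[rule_format, OF eps this]
  \<comment> \<open>The sets \<open>P\<close> and \<open>Q\<close> hold the indices whose first,
    respectively second, coordinate in \<open>F_2 \<times> F_2\<close> is 1; \<open>C\<close> turns
    them into edge sets.\<close>
  define C where "C R = (\<Union>i\<in>R. edge_class D \<phi> us i)" for R
  have "C P \<union> C Q = (\<Union>i\<in>P \<union> Q. edge_class D \<phi> us i)" by (auto simp: C_def)
  also have "\<dots> = arcs D"
  proof -
    have "\<exists>i<length us. \<phi> e = us ! i" if "e \<in> arcs D" for e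
      using that assms(5) by (metis imageI in_set_conv_nth)
    then show ?thesis unfolding PQ edge_class_def by auto
  qed
  finally have cover: "C P \<union> C Q = arcs D" .
  have even_C: "\<forall>v\<in>verts D. even (\<Sum>e\<in>C R. incidence D v e)" if "R = P \<or> R = Q" for R
    unfolding C_def
  proof (intro ballI even_sum_incidence_edge_classes[OF finite_D(2) assms(4)])
    show "R \<subseteq> {..<length us}" using that PQ by blast
    show "even (card (R \<inter> odd_support (eps D \<phi> us v)))" if "v \<in> verts D" for v
      using even_eps[OF that] \<open>R = P \<or> R = Q\<close> by (elim disjE) simp_all
  qed
  show ?thesis
    by (rule admits_4_flow_of_even_cover[OF assms(1,2) cover]) (simp_all add: even_C)
qed

end
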